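(* Let $m\le d$, let $C=C_{\rm axis}\in\mathbb{R}^{m\times m\times m}$, and let $X\in\mathbb{R}^{d\times m}$ have rank $m$. The only real solution $Y\in\mathbb{R}^{d\times m}$ to the tensor equation $[\![C;X,X,X]\!]=[\![C;Y,Y,Y]\!]$ is the matrix $Y=X$.
   Context: The tensor $C_{\rm axis}=(c_{ijk})\in\mathbb{R}^{m\times m\times m}$ has entries $$c_{ijk}=\begin{cases}1&\text{if } i<j<k,\\ \frac12&\text{if } i<j=k\text{ or } i=j<k,\\ \frac16&\text{if } i=j=k,\\ 0&\text{otherwise.}\end{cases}$$ For $X=(x_{ij})\in\mathbb{R}^{d\times m}$, $[\![C;X,X,X]\!]\in\mathbb{R}^{d\times d\times d}$ has entries $[\![C;X,X,X]\!]_{\alpha\beta\gamma}=\sum_{i,j,k=1}^m c_{ijk}\,x_{\alpha i}x_{\beta j}x_{\gamma k}$. (This is the third order signature tensor of the piecewise linear path in $\mathbb{R}^d$ whose steps are the columns of $X$.) *)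

theory Defs
  imports "HOL-Analysis.Analysis"
begin

text \<open>
  The index set \<open>{1..m}\<close> is represented by a finite linearly ordered type \<open>'m\<close> with
  \<open>CARD('m) = m\<close>; the linear order is the one used in comparing tensor indices.
  A \<open>d \<times> m\<close> matrix is an element of \<open>real^'m^'d\<close>, so that \<open>X $ \<alpha> $ i\<close> is the entry
  in row \<open>\<alpha>\<close> and column \<open>i\<close>.
\<close>

type_synonym 'n tensor3 = "real^'n^'n^'n"

definition C_axis :: "('m::{finite,linorder}) tensor3" where
  "C_axis = (\<chi> i j k.
     if i < j \<and> j < k then 1
     else if (i < j \<and> j = k) \<or> (i = j \<and> j < k) then 1 / 2
     else if i = j \<and> j = k then 1 / 6
     else 0)"

definition tensor_congruence :: "('m::finite) tensor3 \<Rightarrow> real^'m^'d \<Rightarrow> ('d::finite) tensor3" where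
  "tensor_congruence C X = (\<chi> \<alpha> \<beta> \<gamma>.
     \<Sum>i\<in>UNIV. \<Sum>j\<in>UNIV. \<Sum>k\<in>UNIV. C $ i $ j $ k * X $ \<alpha> $ i * X $ \<beta> $ j * X $ \<gamma> $ k)"

end

theory Submission
  imports Defs
begin

text \<open>
  Let \<open>V\<close> be upper triangular with diagonal \<open>1\<close> and entries \<open>2\<close> above it. Then
  \<open>12 c\<^sub>i\<^sub>j\<^sub>k = 3 V\<^sub>i\<^sub>j V\<^sub>j\<^sub>k - \<delta>\<^sub>i\<^sub>j\<^sub>k\<close>, so contracting the middle index of \<open>12 C\<close> with \<open>v\<close> gives
  \<open>M v = 3 V diag(v) V - diag(v)\<close>. Suppose \<open>P\<close> fixes \<open>C\<close> and put \<open>A = P\<^sup>T\<close>, so that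
  \<open>P M(A v) A = M v\<close>. The shuffle relations give \<open>P 1 = 1\<close> (this uses uniqueness of real cube
  roots) and \<open>P V A = V\<close>. With \<open>e = (1,-1,1,\<dots>)\<close> and \<open>E = diag(e)\<close> one has \<open>V\<^sup>T e = 1\<close> and
  \<open>V E V = E\<close>, whence \<open>A e = e\<close> and \<open>P E A = E\<close>. Since \<open>v \<mapsto> trace (E M(v))\<close> is the functional
  \<open>2 e\<^sup>T v\<close>, also \<open>P e = e\<close>, and so \<open>A 1 = 1\<close>. The invariance of \<open>M 1 = 3 V\<^sup>2 - 1\<close>
  then says that \<open>Z = A\<^sup>-\<^sup>1 E A - E\<close> satisfies \<open>3 W Z W = Z\<close> for the involution \<open>W = E V\<close>; hence
  \<open>Z = 9 Z\<close> and \<open>A\<close> commutes with \<open>E\<close> and with \<open>V\<close>. A matrix commuting with \<open>V\<close> whose columns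
  sum to \<open>1\<close> is the identity.

  If \<open>X\<close> has full column rank and \<open>Y\<close> has the same tensor, this applies to \<open>P = L Y\<close> for every
  left inverse \<open>L\<close> of \<open>X\<close>, and varying \<open>L\<close> forces \<open>Y = X\<close>.
\<close>

section \<open>Matrices and tensor congruence\<close>

lemma matrix_add_rdistrib: "(A + B) ** C = A ** C + B ** C"
  for A :: "real^'n^'m"
  by (simp add: vec_eq_iff matrix_matrix_mult_def distrib_right sum.distrib)

lemma matrix_diff_ldistrib: "A ** (B - C) = A ** B - A ** C"
  for A :: "real^'n^'m"
  by (simp add: vec_eq_iff matrix_matrix_mult_def right_diff_distrib sum_subtractf)

lemma matrix_diff_rdistrib: "(A - B) ** C = A ** C - B ** C"
  for A :: "real^'n^'m"
  by (simp add: vec_eq_iff matrix_matrix_mult_def left_diff_distrib sum_subtractf)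

lemma matrix_scaleR_left: "(c *\<^sub>R A) ** B = c *\<^sub>R (A ** B)"
  for A :: "real^'n^'m"
  by (simp add: scalar_matrix_assoc)

lemma matrix_scaleR_right: "A ** (c *\<^sub>R B) = c *\<^sub>R (A ** B)"
  for A :: "real^'n^'m"
  by (simp add: matrix_scalar_ac scalar_matrix_assoc)

definition diag_matrix :: "real^'m \<Rightarrow> real^'m^'m" where
  "diag_matrix v = (\<chi> i j. if i = j then v $ i else 0)"

lemma diag_matrix_mult_left: "(diag_matrix v ** M) $ i $ k = v $ i * M $ i $ k"
  by (simp add: diag_matrix_def matrix_matrix_mult_def mult_delta_left)

lemma diag_matrix_mult_vec: "(diag_matrix v *v w) $ i = v $ i * w $ i"
  by (simp add: diag_matrix_def matrix_vector_mult_def mult_delta_left)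

text \<open>Multilinearity. For a left inverse \<open>L\<close> of \<open>X\<close>, this turns the
  equation for \<open>Y\<close> into the statement that \<open>L ** Y\<close> fixes the axis
  tensor.\<close>

lemma tensor_congruence_matrix_mult:
  fixes L :: "real^'d^'e" and X :: "real^'m^'d"
  shows "tensor_congruence C (L ** X) = tensor_congruence (tensor_congruence C X) L"
proof -
  define S where "S = (\<lambda>(f::'d \<Rightarrow> 'd \<Rightarrow> 'd \<Rightarrow> real). \<Sum>a\<in>UNIV. \<Sum>b\<in>UNIV. \<Sum>c\<in>UNIV. f a b c)"
  have swap: "(\<Sum>i\<in>UNIV. S (\<lambda>a b c. f i a b c)) = S (\<lambda>a b c. \<Sum>i\<in>UNIV. f i a b c)"
    for f :: "'m \<Rightarrow> _"
    unfolding S_def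
    by (subst sum.swap, rule sum.cong[OF refl], subst sum.swap, rule sum.cong[OF refl], rule sum.swap)
  have prod: "x * (\<Sum>a\<in>UNIV. f a) * (\<Sum>b\<in>UNIV. g b) * (\<Sum>c\<in>UNIV. h c)
    = S (\<lambda>a b c. x * f a * g b * h c)" for x and f g h :: "'d \<Rightarrow> real"
    unfolding S_def
    by (simp flip: sum_distrib_left sum_distrib_right)
  show ?thesis
    unfolding tensor_congruence_def matrix_matrix_mult_def vec_eq_iff
    by (simp add: prod swap) (simp add: S_def sum_distrib_right sum_distrib_left mult_ac)
qed

lemma tensor_congruence_mat_1: "tensor_congruence C (mat 1) = C"
  by (simp add: vec_eq_iff tensor_congruence_def mat_def mult_delta_right)

section \<open>The matrix form of the axis tensor\<close>

definition axis_matrix :: "real^('m::{finite,linorder})^('m::{finite,linorder})" where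
  "axis_matrix = (\<chi> i j. if i < j then 2 else if i = j then 1 else 0)"

text \<open>The exponent is the zero-based position of \<open>i\<close>, so the least index has sign
  1.\<close>

definition alt_sign :: "'m::{finite,linorder} \<Rightarrow> real" where
  "alt_sign i = (-1) ^ card {..<i}"

lemma finite_linorder_induct:
  fixes k :: "'m::{finite,linorder}"
  assumes "\<And>k. (\<And>j. j < k \<Longrightarrow> Q j) \<Longrightarrow> Q k"
  shows "Q k"
proof (induction "card {..<k}" arbitrary: k rule: less_induct)
  case less
  have "card {..<j} < card {..<k}" if "j < k" for j
    using that by (intro psubset_card_mono) auto
  then show ?case using less assms by blast
qed

lemma alt_sign_square [simp]: "alt_sign i * alt_sign i = 1"
  by (simp add: alt_sign_def flip: power_add)

lemma sum_alt_sign_less: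
  fixes k :: "'m::{finite,linorder}"
  shows "2 * (\<Sum>i | i < k. alt_sign i) = 1 - alt_sign k"
proof (induction k rule: finite_linorder_induct)
  case (1 k)
  show ?case
  proof (cases "{..<k} = {}")
    case True
    then have "{i. i < k} = {}" by auto
    then show ?thesis using True by (simp add: alt_sign_def)
  next
    case False
    \<comment> \<open>The immediate predecessor of \<open>k\<close>: passing it flips the sign and
      lengthens the initial segment by one.\<close>
    define p where "p = Max {..<k}"
    have p: "p < k" and max: "\<And>j. j < k \<Longrightarrow> j \<le> p"
      using Max_in[of "{..<k}"] Max_ge[of "{..<k}"] False by (auto simp: p_def)
    have eq: "{..<k} = insert p {..<p}" "{i. i < k} = insert p {i. i < p}"
      using p max by (auto simp: order.strict_iff_order)
    then have "alt_sign k = - alt_sign p"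
      by (simp add: alt_sign_def)
    then show ?thesis using 1[OF p] eq(2) by (simp add: algebra_simps)
  qed
qed

lemma sum_alt_sign_axis_matrix:
  fixes k :: "'m::{finite,linorder}"
  shows "(\<Sum>i\<in>UNIV. alt_sign i * axis_matrix $ i $ k) = 1"
proof -
  have "(\<Sum>i\<in>UNIV. alt_sign i * axis_matrix $ i $ k)
      = (\<Sum>i\<in>UNIV. (if i < k then 2 * alt_sign i else 0) + (if i = k then alt_sign i else 0))"
    by (intro sum.cong) (auto simp: axis_matrix_def)
  also have "\<dots> = 2 * (\<Sum>i | i < k. alt_sign i) + alt_sign k"
    by (simp add: sum.distrib sum.If_cases sum_distrib_left)
  finally show ?thesis by (simp add: sum_alt_sign_less)
qed

lemma axis_matrix_alt_sign_axis_matrix: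
  fixes i k :: "'m::{finite,linorder}"
  shows "(\<Sum>j\<in>UNIV. axis_matrix $ i $ j * alt_sign j * axis_matrix $ j $ k)
    = (if i = k then alt_sign i else 0)"
proof -
  consider "k < i" | "i = k" | "i < k" by fastforce
  then show ?thesis
  proof cases
    case 1
    then show ?thesis by (auto simp: axis_matrix_def intro!: sum.neutral)
  next
    case 2
    have "axis_matrix $ i $ j * alt_sign j * axis_matrix $ j $ k
        = (if j = i then alt_sign i else 0)" for j :: 'm
      using 2 by (auto simp: axis_matrix_def)
    then show ?thesis using 2 by simp
  next
    case 3
    \<comment> \<open>\<open>V i j = 2 - V j i\<close>, and \<open>V j i\<close> is nonzero only if
      j \<le> i < k, where \<open>V j k = 2\<close>. The alternating sums of columns
      \<open>k\<close> and \<open>i\<close> are both 1, so they cancel.\<close>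
    have "axis_matrix $ i $ j * alt_sign j * axis_matrix $ j $ k
        = 2 * (alt_sign j * axis_matrix $ j $ k) - 2 * (alt_sign j * axis_matrix $ j $ i)" for j :: 'm
      using 3 by (auto simp: axis_matrix_def)
    then show ?thesis using 3 sum_alt_sign_axis_matrix[of k] sum_alt_sign_axis_matrix[of i]
      by (simp add: sum_subtractf flip: sum_distrib_left)
  qed
qed

text \<open>Along weakly increasing indices \<open>3 * V i j * V j k / 12\<close> is 1, 1/2 or 1/4;
  only the full diagonal needs a correction, from 1/4 to 1/6.\<close>

lemma C_axis_eq:
  "C_axis $ i $ j $ k
    = (3 * axis_matrix $ i $ j * axis_matrix $ j $ k - (if i = j \<and> j = k then 1 else 0)) / 12"
  by (cases i j rule: linorder_cases; cases j k rule: linorder_cases)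
    (auto simp: C_axis_def axis_matrix_def)

section \<open>Shuffle relations\<close>

lemma C_axis_simps:
  fixes i j k :: "'m::{finite,linorder}"
  shows C_axis_less_less: "i < j \<Longrightarrow> j < k \<Longrightarrow> C_axis $ i $ j $ k = 1"
    and C_axis_less_eq: "i < j \<Longrightarrow> C_axis $ i $ j $ j = 1 / 2"
    and C_axis_eq_less: "i < j \<Longrightarrow> C_axis $ i $ i $ j = 1 / 2"
    and C_axis_eq_eq: "C_axis $ i $ i $ i = 1 / 6"
    and C_axis_greater1: "j < i \<Longrightarrow> C_axis $ i $ j $ k = 0"
    and C_axis_greater2: "k < j \<Longrightarrow> C_axis $ i $ j $ k = 0"
  unfolding C_axis_def by auto

lemma axis_matrix_simps:
  fixes i j :: "'m::{finite,linorder}"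
  shows "i < j \<Longrightarrow> axis_matrix $ i $ j = 2"
    and "axis_matrix $ i $ i = 1"
    and "j < i \<Longrightarrow> axis_matrix $ i $ j = 0"
  unfolding axis_matrix_def by auto

text \<open>Shuffling the letter \<open>i\<close> into the word \<open>j k\<close> multiplies the
  first level signature of the axis path, all ones, by its second level,
  \<open>V / 2\<close>.\<close>

lemma C_axis_shuffle12:
  "C_axis $ i $ j $ k + C_axis $ j $ i $ k + C_axis $ j $ k $ i = axis_matrix $ j $ k / 2"
proof -
  consider "k < j" | "j = k" "i < j" | "j = k" "i = j" | "j = k" "j < i"
    | "j < k" "i < j" | "j < k" "i = j" | "j < k" "j < i" "i < k" | "j < k" "i = k" | "j < k" "k < i"
    by (metis linorder_cases)
  then show ?thesis
  proof cases
    case 1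
    then have "C_axis $ j $ i $ k = 0"
      by (cases "j \<le> i") (auto intro: C_axis_greater1 C_axis_greater2)
    with 1 show ?thesis by (simp add: C_axis_simps axis_matrix_simps)
  qed (simp_all add: C_axis_simps axis_matrix_simps)
qed

lemma sum_C_axis_shuffle12:
  fixes u v w :: "real^('m::{finite,linorder})"
  defines "T \<equiv> \<lambda>u v w :: real^('m::{finite,linorder}).
    \<Sum>i\<in>UNIV. \<Sum>j\<in>UNIV. \<Sum>k\<in>UNIV. C_axis $ i $ j $ k * u $ i * v $ j * w $ k"
  shows "T u v w + T v u w + T v w u
    = (\<Sum>i\<in>UNIV. u $ i) * (\<Sum>j\<in>UNIV. \<Sum>k\<in>UNIV. v $ j * axis_matrix $ j $ k * w $ k) / 2"
proof -
  have 1: "T v u w = (\<Sum>i\<in>UNIV. \<Sum>j\<in>UNIV. \<Sum>k\<in>UNIV. C_axis $ j $ i $ k * u $ i * v $ j * w $ k)"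
    unfolding T_def by (subst sum.swap) (simp add: mult_ac)
  have "T v w u = (\<Sum>j\<in>UNIV. \<Sum>i\<in>UNIV. \<Sum>k\<in>UNIV. C_axis $ j $ k $ i * u $ i * v $ j * w $ k)"
    unfolding T_def by (subst (2) sum.swap) (simp add: mult_ac)
  then have 2: "T v w u = (\<Sum>i\<in>UNIV. \<Sum>j\<in>UNIV. \<Sum>k\<in>UNIV. C_axis $ j $ k $ i * u $ i * v $ j * w $ k)"
    by (subst sum.swap) simp
  have "T u v w + T v u w + T v w u
    = (\<Sum>i\<in>UNIV. \<Sum>j\<in>UNIV. \<Sum>k\<in>UNIV.
        (C_axis $ i $ j $ k + C_axis $ j $ i $ k + C_axis $ j $ k $ i) * u $ i * v $ j * w $ k)"
    unfolding 1 2 by (simp add: T_def sum.distrib distrib_right)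
  also have "\<dots> = (\<Sum>i\<in>UNIV. \<Sum>j\<in>UNIV. \<Sum>k\<in>UNIV. u $ i * (v $ j * axis_matrix $ j $ k * w $ k) / 2)"
    by (simp add: C_axis_shuffle12 mult_ac)
  finally show ?thesis
    by (subst sum_distrib_right) (simp add: sum_distrib_left sum_divide_distrib)
qed

section \<open>The stabilizer of the axis tensor\<close>

text \<open>This is \<open>M v / 12\<close>.\<close>

definition axis_slice ::
  "real^('m::{finite,linorder}) \<Rightarrow> real^('m::{finite,linorder})^('m::{finite,linorder})" where
  "axis_slice v = (\<chi> i k. \<Sum>j\<in>UNIV. C_axis $ i $ j $ k * v $ j)"

lemma axis_slice_eq:
  fixes v :: "real^('m::{finite,linorder})"
  shows "12 *\<^sub>R axis_slice v = 3 *\<^sub>R (axis_matrix ** diag_matrix v ** axis_matrix) - diag_matrix v"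
proof -
  have "(\<Sum>l\<in>UNIV. (\<Sum>j\<in>UNIV. axis_matrix $ i $ j * diag_matrix v $ j $ l) * axis_matrix $ l $ k)
     = (\<Sum>j\<in>UNIV. axis_matrix $ i $ j * v $ j * axis_matrix $ j $ k)" for i k :: 'm
    by (simp add: diag_matrix_def if_distrib cong: if_cong)
  moreover have "(\<Sum>j\<in>UNIV. (if i = j \<and> j = k then 1 else 0) * v $ j) = diag_matrix v $ i $ k" for i k :: 'm
  proof -
    have "(if i = j \<and> j = k then 1 else 0) * v $ j = (if j = i then diag_matrix v $ i $ k else 0)" for j
      by (auto simp: diag_matrix_def)
    then show ?thesis by simp
  qed
  moreover have "12 * axis_slice v $ i $ k = 3 * (\<Sum>j\<in>UNIV. axis_matrix $ i $ j * v $ j * axis_matrix $ j $ k)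
      - (\<Sum>j\<in>UNIV. (if i = j \<and> j = k then 1 else 0) * v $ j)" for i k :: 'm
    unfolding sum_distrib_left sum_subtractf[symmetric] axis_slice_def
    by (simp only: vec_lambda_beta sum_distrib_left, rule sum.cong[OF refl])
      (simp add: C_axis_eq field_simps)
  ultimately show ?thesis
    by (simp add: vec_eq_iff matrix_matrix_mult_def)
qed

text \<open>The middle factor \<open>P\<close> is absorbed into \<open>v\<close>, leaving
  \<open>P\<close> on the two outer indices; the rest is reordering of sums.\<close>

lemma axis_slice_invariant:
  fixes P :: "real^('m::{finite,linorder})^('m::{finite,linorder})"
  assumes "tensor_congruence C_axis P = C_axis"
  shows "P ** axis_slice (transpose P *v v) ** transpose P = axis_slice v"
proof -
  have rotate: "(\<Sum>i\<in>UNIV. \<Sum>j\<in>UNIV. \<Sum>k\<in>UNIV. f i j k)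
    = (\<Sum>k\<in>UNIV. \<Sum>i\<in>UNIV. \<Sum>j\<in>UNIV. f i j k)" for f :: "'m \<Rightarrow> 'm \<Rightarrow> 'm \<Rightarrow> real"
  proof -
    have "(\<Sum>i\<in>UNIV. \<Sum>j\<in>UNIV. \<Sum>k\<in>UNIV. f i j k)
      = (\<Sum>i\<in>UNIV. \<Sum>k\<in>UNIV. \<Sum>j\<in>UNIV. f i j k)"
      by (rule sum.cong[OF refl], rule sum.swap)
    also have "\<dots> = (\<Sum>k\<in>UNIV. \<Sum>i\<in>UNIV. \<Sum>j\<in>UNIV. f i j k)"
      by (rule sum.swap)
    finally show ?thesis .
  qed
  have "(P ** axis_slice (transpose P *v v) ** transpose P) $ a $ c = axis_slice v $ a $ c" for a c
  proof -
    have "(P ** axis_slice (transpose P *v v) ** transpose P) $ a $ c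
      = (\<Sum>k\<in>UNIV. \<Sum>i\<in>UNIV. \<Sum>j\<in>UNIV. \<Sum>b\<in>UNIV.
          C_axis $ i $ j $ k * P $ a $ i * P $ b $ j * P $ c $ k * v $ b)"
      unfolding matrix_matrix_mult_def matrix_vector_mult_def axis_slice_def transpose_def
      by (simp add: sum_distrib_left sum_distrib_right mult_ac)
    also have "\<dots> = (\<Sum>b\<in>UNIV. \<Sum>i\<in>UNIV. \<Sum>j\<in>UNIV. \<Sum>k\<in>UNIV.
          C_axis $ i $ j $ k * P $ a $ i * P $ b $ j * P $ c $ k * v $ b)"
    proof -
      let ?f = "\<lambda>i j k b. C_axis $ i $ j $ k * P $ a $ i * P $ b $ j * P $ c $ k * v $ b"
      have "(\<Sum>k\<in>UNIV. \<Sum>i\<in>UNIV. \<Sum>j\<in>UNIV. \<Sum>b\<in>UNIV. ?f i j k b)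
        = (\<Sum>k\<in>UNIV. \<Sum>b\<in>UNIV. \<Sum>i\<in>UNIV. \<Sum>j\<in>UNIV. ?f i j k b)"
        by (rule sum.cong[OF refl], rule rotate)
      also have "\<dots> = (\<Sum>b\<in>UNIV. \<Sum>k\<in>UNIV. \<Sum>i\<in>UNIV. \<Sum>j\<in>UNIV. ?f i j k b)"
        by (rule sum.swap)
      also have "\<dots> = (\<Sum>b\<in>UNIV. \<Sum>i\<in>UNIV. \<Sum>j\<in>UNIV. \<Sum>k\<in>UNIV. ?f i j k b)"
        by (rule sum.cong[OF refl], rule rotate[symmetric])
      finally show ?thesis .
    qed
    also have "\<dots> = axis_slice v $ a $ c"
      unfolding axis_slice_def
      by (subst assms[symmetric]) (simp add: tensor_congruence_def sum_distrib_right)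
    finally show ?thesis .
  qed
  then show ?thesis by (simp add: vec_eq_iff)
qed

lemma commuting_axis_matrix_eq_1:
  fixes A :: "real^('m::{finite,linorder})^('m::{finite,linorder})"
  assumes comm: "axis_matrix ** A = A ** axis_matrix"
    and colsum: "\<And>k. (\<Sum>i\<in>UNIV. A $ i $ k) = 1"
  shows "A = mat 1"
proof -
  have "\<forall>i. A $ i $ k = (if i = k then 1 else 0)" for k
  proof (induction k rule: finite_linorder_induct)
    case (1 k)
    \<comment> \<open>In entry \<open>(i, k)\<close> of \<open>V A = A V\<close> the term
      \<open>A $ i $ k\<close> cancels and the columns before \<open>k\<close> are known, which
      fixes every tail sum of column \<open>k\<close>.\<close>
    have gt: "(\<Sum>j | i < j. A $ j $ k) = (if i < k then 1 else 0)" for i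
    proof -
      have "(axis_matrix ** A) $ i $ k
        = (\<Sum>j\<in>UNIV. (if i < j then 2 * A $ j $ k else 0) + (if i = j then A $ j $ k else 0))"
        unfolding matrix_matrix_mult_def axis_matrix_def by (auto intro!: sum.cong)
      also have "\<dots> = 2 * (\<Sum>j | i < j. A $ j $ k) + A $ i $ k"
        by (simp add: sum.distrib sum.If_cases sum_distrib_left)
      finally have l: "(axis_matrix ** A) $ i $ k = 2 * (\<Sum>j | i < j. A $ j $ k) + A $ i $ k" .
      have "(A ** axis_matrix) $ i $ k
        = (\<Sum>j\<in>UNIV. (if j < k then 2 * A $ i $ j else 0) + (if j = k then A $ i $ j else 0))"
        unfolding matrix_matrix_mult_def axis_matrix_def by (auto intro!: sum.cong)
      also have "\<dots> = 2 * (\<Sum>j | j < k. A $ i $ j) + A $ i $ k"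
        by (simp add: sum.distrib sum.If_cases sum_distrib_left)
      also have "(\<Sum>j | j < k. A $ i $ j) = (\<Sum>j | j < k. if i = j then 1 else 0)"
        using 1 by (intro sum.cong) auto
      also have "\<dots> = (if i < k then 1 else 0)" by simp
      finally show ?thesis using l comm by simp
    qed
    \<comment> \<open>Going down column \<open>k\<close>, the rows above \<open>i\<close> are known
      and \<open>gt\<close> gives the tail, so the column sum 1 determines the entry.\<close>
    have "A $ i $ k = (if i = k then 1 else 0)" for i
    proof (induction i rule: finite_linorder_induct)
      case (1 i)
      have "UNIV = {j. j < i} \<union> ({i} \<union> {j. i < j})" by auto
      then have "(\<Sum>j\<in>UNIV. A $ j $ k) = (\<Sum>j\<in>{j. j < i} \<union> ({i} \<union> {j. i < j}). A $ j $ k)" by simp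
      also have "\<dots> = (\<Sum>j | j < i. A $ j $ k) + (A $ i $ k + (\<Sum>j | i < j. A $ j $ k))"
        by (subst sum.union_disjoint; auto)
      also have "(\<Sum>j | j < i. A $ j $ k) = (\<Sum>j | j < i. if j = k then 1 else 0)"
        using 1 by (intro sum.cong) auto
      also have "\<dots> = (if k < i then 1 else 0)" by simp
      finally show ?case using gt[of i] colsum[of k] by (auto split: if_splits)
    qed
    then show ?case by blast
  qed
  then show ?thesis by (simp add: vec_eq_iff mat_def)
qed

section \<open>Shuffle relations for a stabilizing matrix\<close>

lemma stabilizer_entry:
  fixes P :: "real^('m::{finite,linorder})^('m::{finite,linorder})"
  assumes "tensor_congruence C_axis P = C_axis"
  shows "(\<Sum>i\<in>UNIV. \<Sum>j\<in>UNIV. \<Sum>k\<in>UNIV. C_axis $ i $ j $ k * P $ a $ i * P $ b $ j * P $ c $ k)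
    = C_axis $ a $ b $ c"
  using assms by (simp add: vec_eq_iff tensor_congruence_def)

text \<open>Only the symmetric part counts, and every entry of \<open>V + transpose V\<close> is
  2.\<close>

lemma axis_matrix_quadratic_form:
  fixes p :: "real^('m::{finite,linorder})"
  shows "(\<Sum>j\<in>UNIV. \<Sum>k\<in>UNIV. p $ j * axis_matrix $ j $ k * p $ k) = (\<Sum>j\<in>UNIV. p $ j)\<^sup>2"
proof -
  let ?S = "\<Sum>j\<in>UNIV. \<Sum>k\<in>UNIV. p $ j * axis_matrix $ j $ k * p $ k"
  have "?S = (\<Sum>j\<in>UNIV. \<Sum>k\<in>UNIV. p $ j * axis_matrix $ k $ j * p $ k)"
    by (subst sum.swap) (simp add: mult_ac)
  then have "2 * ?S = (\<Sum>j\<in>UNIV. \<Sum>k\<in>UNIV. p $ j * (axis_matrix $ j $ k + axis_matrix $ k $ j) * p $ k)"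
    by (simp add: distrib_left distrib_right sum.distrib)
  also have "\<dots> = (\<Sum>j\<in>UNIV. \<Sum>k\<in>UNIV. 2 * (p $ j * p $ k))"
    by (intro sum.cong refl) (auto simp: axis_matrix_def)
  also have "\<dots> = 2 * (\<Sum>j\<in>UNIV. p $ j)\<^sup>2"
    by (simp only: power2_eq_square sum_product) (simp only: sum_distrib_left)
  finally show ?thesis by simp
qed

text \<open>With row \<open>a\<close> in all three places the shuffle relation reads 3/6 = r^3/2,
  and 1 is the only real cube root of 1.\<close>

lemma stabilizer_row_sum:
  fixes P :: "real^('m::{finite,linorder})^('m::{finite,linorder})"
  assumes "tensor_congruence C_axis P = C_axis"
  shows "(\<Sum>i\<in>UNIV. P $ a $ i) = 1"
proof -
  define r where "r = (\<Sum>i\<in>UNIV. P $ a $ i)"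
  have "r * r\<^sup>2 = 1"
    using sum_C_axis_shuffle12[of "P $ a" "P $ a" "P $ a"]
    by (simp add: stabilizer_entry[OF assms] axis_matrix_quadratic_form C_axis_eq_eq r_def)
  then have "(r - 1) * (r\<^sup>2 + r + 1) = 0"
    by (simp add: algebra_simps power2_eq_square)
  moreover have "r\<^sup>2 + r + 1 = (r + 1 / 2)\<^sup>2 + 3 / 4"
    by (simp add: power2_eq_square algebra_simps)
  then have "r\<^sup>2 + r + 1 > 0"
    by (metis add_nonneg_pos zero_le_power2 zero_less_divide_iff zero_less_numeral)
  ultimately show ?thesis by (simp add: r_def)
qed

text \<open>As the row sums are 1, the shuffle relation for rows \<open>b\<close>, \<open>b\<close>,
  \<open>c\<close> has half the entry \<open>(b, c)\<close> of \<open>P V A\<close> on the right; by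
  invariance its left side is \<open>V b c / 2\<close>.\<close>

lemma stabilizer_axis_matrix:
  fixes P :: "real^('m::{finite,linorder})^('m::{finite,linorder})"
  assumes "tensor_congruence C_axis P = C_axis"
  shows "P ** axis_matrix ** transpose P = axis_matrix"
proof -
  have "(P ** axis_matrix ** transpose P) $ b $ c = axis_matrix $ b $ c" for b c
  proof -
    have "(\<Sum>j\<in>UNIV. \<Sum>k\<in>UNIV. P $ b $ j * axis_matrix $ j $ k * P $ c $ k) = axis_matrix $ b $ c"
      using sum_C_axis_shuffle12[of "P $ b" "P $ b" "P $ c"] C_axis_shuffle12[of b b c]
      by (simp add: stabilizer_entry[OF assms] stabilizer_row_sum[OF assms])
    then show ?thesis
      by (subst (asm) sum.swap) (simp add: matrix_matrix_mult_def transpose_def sum_distrib_right)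
  qed
  then show ?thesis by (simp add: vec_eq_iff)
qed

section \<open>The diagonal matrix of alternating signs\<close>

definition alt_diag :: "real^('m::{finite,linorder})^('m::{finite,linorder})" where
  "alt_diag = diag_matrix (vec_lambda alt_sign)"

lemma alt_diag_square: "alt_diag ** alt_diag = mat 1"
  by (simp add: vec_eq_iff alt_diag_def diag_matrix_mult_left) (simp add: diag_matrix_def mat_def)

lemma alt_diag_one: "alt_diag *v 1 = vec_lambda alt_sign"
  by (simp add: vec_eq_iff alt_diag_def diag_matrix_mult_vec)

lemma axis_alt_axis: "axis_matrix ** alt_diag ** axis_matrix = alt_diag"
proof -
  have "axis_matrix ** (alt_diag ** axis_matrix) = alt_diag"
    by (simp add: vec_eq_iff matrix_matrix_mult_def[of axis_matrix] alt_diag_def diag_matrix_mult_left)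
      (simp add: axis_matrix_alt_sign_axis_matrix diag_matrix_def flip: mult.assoc)
  then show ?thesis by (simp add: matrix_mul_assoc)
qed

lemma axis_slice_alt:
  defines "E \<equiv> alt_diag :: real^('m::{finite,linorder})^('m::{finite,linorder})"
  shows "6 *\<^sub>R axis_slice (vec_lambda alt_sign) = E"
proof -
  have "12 *\<^sub>R axis_slice (vec_lambda alt_sign) = 2 *\<^sub>R E"
    by (simp add: E_def axis_slice_eq axis_alt_axis scaleR_left_diff_distrib[of 3 1, simplified]
        flip: alt_diag_def)
  then have "(1 / 2) *\<^sub>R 12 *\<^sub>R axis_slice (vec_lambda alt_sign) = (1 / 2) *\<^sub>R 2 *\<^sub>R E"
    by (rule arg_cong)
  then show ?thesis by simp
qed

lemma diag_matrix_one: "diag_matrix 1 = mat 1"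
  by (simp add: vec_eq_iff diag_matrix_def mat_def)

lemma axis_slice_one: "12 *\<^sub>R axis_slice 1 = 3 *\<^sub>R (axis_matrix ** axis_matrix) - mat 1"
  by (simp add: axis_slice_eq diag_matrix_one)

text \<open>Only entries of \<open>C_axis\<close> with equal outer indices enter the trace; they
  vanish unless the middle index agrees too, and are then 1/6.\<close>

lemma trace_alt_diag_axis_slice:
  fixes v :: "real^('m::{finite,linorder})"
  shows "trace (alt_diag ** axis_slice v) = (vec_lambda alt_sign \<bullet> v) / 6"
proof -
  have "C_axis $ i $ j $ i * v $ j = (if j = i then v $ i / 6 else 0)" for i j
    by (cases i j rule: linorder_cases) (auto simp: C_axis_simps)
  then show ?thesis
    by (simp add: trace_def alt_diag_def diag_matrix_mult_left axis_slice_def inner_vec_def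
        sum_divide_distrib)
qed

lemma transpose_axis_alt_sign: "transpose axis_matrix *v vec_lambda alt_sign = 1"
  by (simp add: vec_eq_iff vector_matrix_mult_def sum_alt_sign_axis_matrix
      flip: mult.commute[of "alt_sign _"])

lemma stabilizer_C_axis:
  fixes P :: "real^('m::{finite,linorder})^('m::{finite,linorder})"
  assumes P: "tensor_congruence C_axis P = C_axis"
  shows "P = mat 1"
proof -
  let ?V = "axis_matrix :: real^('m::{finite,linorder})^('m::{finite,linorder})"
    and ?E = "alt_diag :: real^('m::{finite,linorder})^('m::{finite,linorder})"
    and ?e = "vec_lambda alt_sign :: real^('m::{finite,linorder})"
  define A where "A = transpose P"
  have AP: "transpose A = P" by (simp add: A_def)
  note assoc = matrix_mul_assoc[symmetric]
  have EE: "?E ** ?E = mat 1" and VEV: "?V ** (?E ** ?V) = ?E"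
    using alt_diag_square axis_alt_axis by (simp_all add: assoc)
  have EE': "?E ** (?E ** Q) = Q" and VEV': "?V ** (?E ** (?V ** Q)) = ?E ** Q" for Q
    using EE VEV by (simp_all add: matrix_mul_assoc)
  have P1: "P *v 1 = 1"
    using stabilizer_row_sum[OF P] by (simp add: vec_eq_iff matrix_vector_mult_def)
  have PVA: "P ** (?V ** A) = ?V"
    using stabilizer_axis_matrix[OF P] by (simp add: A_def assoc)
  have slice: "P ** (axis_slice (A *v v) ** A) = axis_slice v" for v
    using axis_slice_invariant[OF P] by (simp add: A_def assoc)
  \<comment> \<open>Since \<open>V E V = E\<close>, the matrix \<open>E V E\<close> is inverse to
    \<open>V = P V A\<close>, so \<open>P\<close> is invertible.\<close>
  have "P ** (?V ** (A ** (?E ** ?V ** ?E))) = mat 1"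
    using PVA VEV EE by (metis assoc)
  then obtain P' where PP': "P ** P' = mat 1" and P'P: "P' ** P = mat 1"
    using matrix_left_right_inverse by blast
  define A' where "A' = transpose P'"
  have AA': "A ** A' = mat 1" and A'A: "A' ** A = mat 1"
    using PP' P'P by (metis A_def A'_def matrix_transpose_mul transpose_mat)+
  have cancel: "P ** (P' ** Q) = Q" "P' ** (P ** Q) = Q" "A ** (A' ** Q) = Q" "A' ** (A ** Q) = Q" for Q
    by (simp_all add: matrix_mul_assoc PP' P'P AA' A'A)

  \<comment> \<open>Transposing \<open>P V A = V\<close> and using \<open>V\<^sup>T e = 1\<close>
    and \<open>P 1 = 1\<close> shows that \<open>P V\<^sup>T\<close> sends both \<open>A e\<close>
    and \<open>e\<close> to 1; then \<open>P\<close> and \<open>V\<^sup>T\<close> are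
    cancelled.\<close>
  have Ae: "A *v ?e = ?e"
  proof -
    let ?T = "transpose ?V"
    have "P ** (?T ** A) = ?T"
      using arg_cong[OF PVA, of transpose] by (simp add: matrix_transpose_mul AP assoc A_def)
    then have "P *v (?T *v (A *v ?e)) = P *v (?T *v ?e)"
      by (metis P1 matrix_vector_mul_assoc transpose_axis_alt_sign)
    then have 1: "?T *v (A *v ?e) = ?T *v ?e"
      by (metis P'P matrix_vector_mul_assoc matrix_vector_mul_lid)
    have "transpose (?V ** (?E ** (?V ** ?E))) = mat 1"
      by (simp add: VEV' EE)
    then have "transpose (?E ** (?V ** ?E)) ** ?T = mat 1"
      by (simp add: matrix_transpose_mul)
    then show ?thesis
      using 1 by (metis matrix_vector_mul_assoc matrix_vector_mul_lid)
  qed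
  have PEA: "P ** (?E ** A) = ?E"
    using slice[of ?e, unfolded Ae] axis_slice_alt
    by (metis matrix_scaleR_left matrix_scaleR_right)
  \<comment> \<open>\<open>P E\<close> and \<open>A E\<close> are square and inverse to each other,
    so their order can be exchanged.\<close>
  have AEP: "A ** (?E ** P) = ?E"
  proof -
    have "(P ** ?E) ** (A ** ?E) = mat 1" using PEA EE by (metis assoc)
    then have "(A ** ?E) ** (P ** ?E) = mat 1" using matrix_left_right_inverse by blast
    then show ?thesis using EE by (metis assoc matrix_mul_lid matrix_mul_rid)
  qed
  \<comment> \<open>Cyclicity of the trace and \<open>A E P = E\<close> make the functional
    \<open>trace (E M(v))\<close> invariant under \<open>A\<close>; it is a multiple of
    \<open>e\<^sup>T v\<close>.\<close>
  have Pe: "P *v ?e = ?e"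
  proof -
    have "?e \<bullet> (A *v v) = ?e \<bullet> v" for v
    proof -
      have "trace (?E ** axis_slice v) = trace ((?E ** P ** axis_slice (A *v v)) ** A)"
        by (simp add: assoc slice)
      also have "\<dots> = trace (?E ** axis_slice (A *v v))"
        by (subst trace_mul_sym) (simp add: matrix_mul_assoc AEP[unfolded matrix_mul_assoc])
      finally show ?thesis by (simp add: trace_alt_diag_axis_slice)
    qed
    then have "(P *v ?e) \<bullet> v = ?e \<bullet> v" for v
      by (metis A_def dot_lmul_matrix inner_commute transpose_matrix_vector)
    then show ?thesis by (metis vector_eq_rdot)
  qed
  have A1: "A *v 1 = 1"
  proof -
    have "?E *v ?e = 1"
      using alt_diag_one EE by (metis matrix_vector_mul_assoc matrix_vector_mul_lid)
    then show ?thesis using AEP Pe by (metis matrix_vector_mul_assoc)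
  qed

  have PE: "P ** Q = ?E ** (A' ** (?E ** Q))" for Q
  proof -
    have "P = ?E ** (A' ** ?E)"
      using PEA EE AA' by (metis assoc matrix_mul_rid)
    then show ?thesis by (metis assoc)
  qed
  have VA: "?V ** A = ?E ** (A ** (?E ** ?V))"
  proof -
    have "?E ** (A' ** (?E ** (?V ** A))) = ?V" using PVA unfolding PE .
    then show ?thesis using EE' cancel by metis
  qed
  define W where "W = ?E ** ?V"
  have WW: "W ** W = mat 1" and WW': "W ** (W ** Q) = Q" for Q
    by (simp_all add: W_def assoc VEV VEV' EE EE')
  define Z where "Z = A' ** (?E ** A) - ?E"
  have "3 *\<^sub>R (P ** (?V ** (?V ** A))) - P ** A = 3 *\<^sub>R (?V ** ?V) - mat 1"
  proof -
    have "P ** ((12 *\<^sub>R axis_slice 1) ** A) = 12 *\<^sub>R axis_slice 1"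
      using slice[of 1, unfolded A1] by (simp add: matrix_scaleR_left matrix_scaleR_right)
    then show ?thesis
      by (simp add: axis_slice_one matrix_diff_ldistrib matrix_diff_rdistrib
          matrix_scaleR_left matrix_scaleR_right assoc)
  qed
  then have "3 *\<^sub>R (?E ** (P ** (?V ** (?V ** A)))) - ?E ** (P ** A) = 3 *\<^sub>R (?E ** (?V ** ?V)) - ?E"
    by (metis matrix_diff_ldistrib matrix_scaleR_right matrix_mul_rid)
  \<comment> \<open>Inserting \<open>A A'\<close> between the two factors \<open>V\<close> lets
    \<open>P V A = V\<close> absorb the left one; \<open>VA\<close> rewrites the other.\<close>
  moreover have "?E ** (P ** (?V ** (?V ** A))) = W ** ((A' ** (?E ** A)) ** W)"
  proof -
    have "P ** (?V ** (?V ** A)) = P ** (?V ** (A ** (A' ** (?V ** A))))" by (simp add: cancel)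
    also have "\<dots> = ?V ** (A' ** (?V ** A))" using PVA by (metis assoc)
    also have "\<dots> = ?V ** (A' ** (?E ** (A ** (?E ** ?V))))" by (simp add: VA)
    finally show ?thesis by (simp add: W_def assoc)
  qed
  moreover have "?E ** (P ** A) = A' ** (?E ** A)" by (simp add: PE EE')
  moreover have "?E ** (?V ** ?V) = W ** (?E ** W)" by (simp add: W_def assoc EE')
  ultimately have Z: "3 *\<^sub>R (W ** (Z ** W)) = Z"
    by (simp add: Z_def matrix_diff_ldistrib matrix_diff_rdistrib algebra_simps)
  \<comment> \<open>Conjugating the relation \<open>Z\<close> once more by the involution
    \<open>W\<close>; the two relations together give \<open>Z = 9 Z\<close>.\<close>
  have "W ** (Z ** W) = 3 *\<^sub>R Z"
  proof -
    have "W ** (Z ** W) = W ** ((3 *\<^sub>R (W ** (Z ** W))) ** W)" by (simp add: Z)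
    also have "\<dots> = 3 *\<^sub>R Z"
      by (simp add: matrix_scaleR_left matrix_scaleR_right assoc WW WW')
    finally show ?thesis .
  qed
  then have "9 *\<^sub>R Z = Z" using Z by simp
  then have "Z = 0" by (simp add: vec_eq_iff)
  then have "A' ** (?E ** A) = ?E" by (simp add: Z_def)
  then have EA: "?E ** A = A ** ?E" by (metis cancel(3))
  have "?V ** A = A ** ?V"
    using VA EA EE' by (metis assoc)
  moreover have "(\<Sum>i\<in>UNIV. A $ i $ k) = 1" for k
    using stabilizer_row_sum[OF P, of k] by (simp add: A_def transpose_def)
  ultimately have "A = mat 1" by (rule commuting_axis_matrix_eq_1)
  then show ?thesis using AP by simp
qed

section \<open>From the stabilizer to matrices of full column rank\<close>

theorem corollary6p3:
  fixes X :: "real^('m::{finite,linorder})^('d::finite)"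
  assumes "CARD('m) \<le> CARD('d)"
    and "rank X = CARD('m)"
  shows "{Y. tensor_congruence C_axis X = tensor_congruence C_axis Y} = {X}"
proof -
  have "Y = X" if XY: "tensor_congruence C_axis X = tensor_congruence C_axis Y" for Y
  proof -
    have LY: "L ** Y = mat 1" if "L ** X = mat 1" for L :: "real^'d^('m::{finite,linorder})"
    proof -
      have "tensor_congruence C_axis (L ** Y) = tensor_congruence C_axis (L ** X)"
        by (simp add: tensor_congruence_matrix_mult XY)
      also have "\<dots> = C_axis"
        by (simp add: that tensor_congruence_mat_1)
      finally show ?thesis by (rule stabilizer_C_axis)
    qed
    obtain L :: "real^'d^('m::{finite,linorder})" where L: "L ** X = mat 1"
      using assms(2) by (metis full_rank_injective matrix_left_invertible_injective)
    \<comment> \<open>\<open>R\<close> annihilates \<open>X\<close>, so \<open>L + K ** R\<close> is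
      a left inverse of \<open>X\<close> for every \<open>K\<close>.\<close>
    define R where "R = mat 1 - X ** L"
    have RX: "R ** X = 0"
      by (simp add: R_def matrix_diff_rdistrib L flip: matrix_mul_assoc)
    have "K ** (R ** Y) = 0" for K :: "real^'d^('m::{finite,linorder})"
    proof -
      have "(L + K ** R) ** X = mat 1"
        by (simp add: matrix_add_rdistrib L RX flip: matrix_mul_assoc)
      from LY[OF this] show ?thesis
        by (simp add: matrix_add_rdistrib LY[OF L] flip: matrix_mul_assoc)
    qed
    \<comment> \<open>Every row of this \<open>K\<close> is the unit vector at \<open>a\<close>, so
      \<open>K ** (R ** Y)\<close> repeats row \<open>a\<close> of \<open>R ** Y\<close>.\<close>
    then have "(\<chi> i j. if j = a then 1 else 0) ** (R ** Y)
      = (0 :: real^('m::{finite,linorder})^('m::{finite,linorder}))" for a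
      by blast
    then have "R ** Y = 0"
      by (simp add: vec_eq_iff matrix_matrix_mult_def[of "vec_lambda _"] mult_delta_left)
    then have "Y = X ** (L ** Y)"
      by (simp add: R_def matrix_diff_rdistrib matrix_mul_assoc)
    then show ?thesis by (simp add: LY[OF L])
  qed
  then show ?thesis by auto
qed

end
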